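(* For every finite simple graph $G$, the edge-biclique hypergraph $\mathcal{EB}(G)$ is equal to the clique hypergraph $\mathcal{K}(L_G)$ of the biclique line graph $L_G$ if and only if $G$ contains no induced subgraph isomorphic to the triangular prism.
   Context: Graphs are finite and simple. A biclique of $G$ is a vertex set $B\subseteq V(G)$ such that $G[B]$ is a complete bipartite graph and $B$ is inclusion-wise maximal with this property. A clique of a graph is an inclusion-wise maximal vertex set inducing a complete graph. The edge-biclique hypergraph $\mathcal{EB}(G)$ has vertex set $E(G)$ and its hyperedges are the edge sets $E(G[B])$ of the bicliques $B$ of $G$. The biclique line graph $L_G$ is the graph with vertex set $E(G)$ in which two edges of $G$ are adjacent iff they both are edges of $G[B]$ for some common biclique $B$ of $G$ (i.e. $L_G$ is the 2-section of $\mathcal{EB}(G)$). The clique hypergraph $\mathcal{K}(H)$ of a graph $H$ has vertex set $V(H)$ and the cliques of $H$ as hyperedges. The triangular prism is the graph on vertices $a,b,c,d,e,f$ consisting of the triangles $abc$ and $def$ together with the edges $ad,be,cf$. *)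

theory Defs
  imports Main
begin

text \<open>
  A graph or a hypergraph is a pair of a vertex set and a set of (hyper)edges, where each
  (hyper)edge is a set of vertices. Undirected edges are two-element sets, so a graph whose
  vertices are the edges of a graph on \<open>'a\<close> is a graph on \<open>'a set\<close>.
\<close>

type_synonym 'a hypergraph = "'a set \<times> 'a set set"

abbreviation verts :: "'a hypergraph \<Rightarrow> 'a set" where
  "verts G \<equiv> fst G"

abbreviation edges :: "'a hypergraph \<Rightarrow> 'a set set" where
  "edges G \<equiv> snd G"

definition finite_simple_graph :: "'a hypergraph \<Rightarrow> bool" where
  "finite_simple_graph G \<longleftrightarrow>
     finite (verts G) \<and> (\<forall>e\<in>edges G. e \<subseteq> verts G \<and> card e = 2)"

definition induced_subgraph :: "'a hypergraph \<Rightarrow> 'a set \<Rightarrow> 'a hypergraph" where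
  "induced_subgraph G S = (S, {e \<in> edges G. e \<subseteq> S})"

definition graph_isomorphic :: "'a hypergraph \<Rightarrow> 'b hypergraph \<Rightarrow> bool" where
  "graph_isomorphic G H \<longleftrightarrow>
     (\<exists>f. bij_betw f (verts G) (verts H) \<and> edges H = (\<lambda>e. f ` e) ` edges G)"

text \<open>
  The graph without vertices does not count as complete, and both sides of a complete bipartite
  graph are nonempty. So an edgeless graph has no bicliques, isolated vertices do not
  contribute an empty hyperedge, and the graph without vertices has no cliques.
\<close>

definition complete_graph :: "'a hypergraph \<Rightarrow> bool" where
  "complete_graph G \<longleftrightarrow>
     verts G \<noteq> {} \<and> edges G = {e. e \<subseteq> verts G \<and> card e = 2}"

definition complete_bipartite_graph :: "'a hypergraph \<Rightarrow> bool" where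
  "complete_bipartite_graph G \<longleftrightarrow>
     (\<exists>X Y. X \<noteq> {} \<and> Y \<noteq> {} \<and> X \<inter> Y = {} \<and> verts G = X \<union> Y \<and>
        edges G = {{x, y} | x y. x \<in> X \<and> y \<in> Y})"

definition is_clique :: "'a hypergraph \<Rightarrow> 'a set \<Rightarrow> bool" where
  "is_clique G C \<longleftrightarrow>
     C \<subseteq> verts G \<and> complete_graph (induced_subgraph G C) \<and>
     (\<forall>C'. C \<subseteq> C' \<and> C' \<subseteq> verts G \<and> complete_graph (induced_subgraph G C') \<longrightarrow> C' = C)"

definition is_biclique :: "'a hypergraph \<Rightarrow> 'a set \<Rightarrow> bool" where
  "is_biclique G B \<longleftrightarrow>
     B \<subseteq> verts G \<and> complete_bipartite_graph (induced_subgraph G B) \<and>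
     (\<forall>B'. B \<subseteq> B' \<and> B' \<subseteq> verts G \<and> complete_bipartite_graph (induced_subgraph G B')
        \<longrightarrow> B' = B)"

definition clique_hypergraph :: "'a hypergraph \<Rightarrow> 'a hypergraph" where
  "clique_hypergraph G = (verts G, {C. is_clique G C})"

definition edge_biclique_hypergraph :: "'a hypergraph \<Rightarrow> 'a set hypergraph" where
  "edge_biclique_hypergraph G =
     (edges G, {edges (induced_subgraph G B) | B. is_biclique G B})"

definition biclique_line_graph :: "'a hypergraph \<Rightarrow> 'a set hypergraph" where
  "biclique_line_graph G =
     (edges G,
      {{e, e'} | e e'. e \<in> edges G \<and> e' \<in> edges G \<and> e \<noteq> e' \<and>
         (\<exists>B. is_biclique G B \<and> e \<in> edges (induced_subgraph G B) \<and>
              e' \<in> edges (induced_subgraph G B))})"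

definition triangular_prism :: "nat hypergraph" where
  "triangular_prism =
     ({0, 1, 2, 3, 4, 5},
      {{0, 1}, {1, 2}, {0, 2}, {3, 4}, {4, 5}, {3, 5}, {0, 3}, {1, 4}, {2, 5}})"

end

theory Submission
  imports Defs
begin

text \<open>
  A vertex set with at least one edge induces a complete bipartite graph iff every three of its
  vertices span an even number of edges. So the hyperedges of both hypergraphs are the maximal
  nonempty edge sets with a property inherited by subsets: all triples in the union of the set are
  even, respectively all triples in the union of any two members are even. The hypergraphs agree iff
  the two properties do, and as a triple meets at most three edges, only sets of three edges matter.

  If all triples in \<open>xx' \<union> yy'\<close> are even, then these two edges are joined by exactly one of the
  matchings \<open>xy, x'y'\<close> and \<open>xy', x'y\<close>. Hence, for three edges \<open>xx'\<close>, \<open>yy'\<close>, \<open>zz'\<close> that pairwise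
  have this property, the adjacencies of \<open>x\<close>, \<open>y\<close>, \<open>z\<close> determine all others, and exchanging the
  ends of an edge flips two of them. If the three edges together have an odd triple, one may thus
  take \<open>xyz\<close> to be a triangle, and the edges are the rungs of an induced prism.
\<close>

section \<open>Maximal members of a family of sets\<close>

definition maximal_sets :: "'a set set \<Rightarrow> 'a set set" where
  "maximal_sets F = {M \<in> F. \<forall>A\<in>F. M \<subseteq> A \<longrightarrow> M = A}"

definition nonempty_subset_closed :: "'a set set \<Rightarrow> bool" where
  "nonempty_subset_closed F \<longleftrightarrow> {} \<notin> F \<and> (\<forall>A\<in>F. \<forall>B\<subseteq>A. B \<noteq> {} \<longrightarrow> B \<in> F)"

lemma mem_iff_subset_maximal_set:
  assumes "finite F" "nonempty_subset_closed F"
  shows "A \<in> F \<longleftrightarrow> A \<noteq> {} \<and> (\<exists>M\<in>maximal_sets F. A \<subseteq> M)"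
proof
  assume A: "A \<in> F"
  have "\<exists>M\<in>maximal_sets F. A \<subseteq> M"
    using finite_has_maximal2[OF assms(1) A] by (auto simp: maximal_sets_def)
  moreover have "A \<noteq> {}"
    using A assms(2) by (auto simp: nonempty_subset_closed_def)
  ultimately show "A \<noteq> {} \<and> (\<exists>M\<in>maximal_sets F. A \<subseteq> M)"
    by simp
next
  assume "A \<noteq> {} \<and> (\<exists>M\<in>maximal_sets F. A \<subseteq> M)"
  then show "A \<in> F"
    using assms(2) unfolding nonempty_subset_closed_def maximal_sets_def by blast
qed

lemma maximal_sets_eq_iff:
  assumes "finite F" "nonempty_subset_closed F" "finite F'" "nonempty_subset_closed F'"
  shows "maximal_sets F = maximal_sets F' \<longleftrightarrow> F = F'"
  using mem_iff_subset_maximal_set[OF assms(1,2)] mem_iff_subset_maximal_set[OF assms(3,4)] by auto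

section \<open>Induced subgraphs and embeddings\<close>

lemma verts_induced_subgraph [simp]: "verts (induced_subgraph G S) = S"
  by (simp add: induced_subgraph_def)

lemma edges_induced_subgraph [simp]: "edges (induced_subgraph G S) = {e \<in> edges G. e \<subseteq> S}"
  by (simp add: induced_subgraph_def)

lemma clique_hypergraph_eq:
  "clique_hypergraph H =
    (verts H, maximal_sets {C. C \<subseteq> verts H \<and> complete_graph (induced_subgraph H C)})"
  by (auto simp: clique_hypergraph_def is_clique_def maximal_sets_def)

definition induced_embedding :: "'b hypergraph \<Rightarrow> 'a hypergraph \<Rightarrow> ('b \<Rightarrow> 'a) \<Rightarrow> bool" where
  "induced_embedding H G g \<longleftrightarrow> inj_on g (verts H) \<and> g ` verts H \<subseteq> verts G \<and>
     (\<forall>i\<in>verts H. \<forall>j\<in>verts H. {g i, g j} \<in> edges G \<longleftrightarrow> {i, j} \<in> edges H)"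

locale simple_graph =
  fixes G :: "'a hypergraph"
  assumes edge_subset_verts: "e \<in> edges G \<Longrightarrow> e \<subseteq> verts G"
    and card_edge: "e \<in> edges G \<Longrightarrow> card e = 2"
begin

lemma edgeE:
  assumes "e \<in> edges G"
  obtains x y where "e = {x, y}" "x \<in> verts G" "y \<in> verts G"
  using card_edge[OF assms] edge_subset_verts[OF assms] unfolding card_2_iff by blast

lemma singleton_not_edge [simp]: "{x} \<notin> edges G"
  using card_edge by fastforce

lemma finite_edges: "finite (verts G) \<Longrightarrow> finite (edges G)"
  using edge_subset_verts by (auto intro: finite_subset[of _ "Pow (verts G)"])

lemma simple_graph_induced_subgraph: "simple_graph (induced_subgraph G S)"
  by unfold_locales (simp_all add: card_edge)

lemma complete_induced_subgraph_iff:
  "complete_graph (induced_subgraph G C) \<longleftrightarrow>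
    C \<noteq> {} \<and> (\<forall>x\<in>C. \<forall>y\<in>C. x \<noteq> y \<longrightarrow> {x, y} \<in> edges G)"
  using card_edge unfolding complete_graph_def by (auto simp: card_2_iff)

end

lemma edges_eq_image_iff:
  assumes "simple_graph G" "simple_graph H" and f: "bij_betw f (verts G) (verts H)"
  shows "edges H = (\<lambda>e. f ` e) ` edges G \<longleftrightarrow>
    (\<forall>x\<in>verts G. \<forall>y\<in>verts G. {x, y} \<in> edges G \<longleftrightarrow> {f x, f y} \<in> edges H)"
proof
  assume eq: "edges H = (\<lambda>e. f ` e) ` edges G"
  show "\<forall>x\<in>verts G. \<forall>y\<in>verts G. {x, y} \<in> edges G \<longleftrightarrow> {f x, f y} \<in> edges H"
  proof (intro ballI)
    fix x y assume "x \<in> verts G" "y \<in> verts G"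
    then have "f ` {x, y} = f ` e \<longleftrightarrow> {x, y} = e" if "e \<in> edges G" for e
      using f simple_graph.edge_subset_verts[OF assms(1) that]
      by (intro inj_on_image_eq_iff[of f "verts G"]) (auto simp: bij_betw_def)
    then show "{x, y} \<in> edges G \<longleftrightarrow> {f x, f y} \<in> edges H"
      unfolding eq by auto
  qed
next
  assume adj: "\<forall>x\<in>verts G. \<forall>y\<in>verts G. {x, y} \<in> edges G \<longleftrightarrow> {f x, f y} \<in> edges H"
  show "edges H = (\<lambda>e. f ` e) ` edges G"
  proof (intro equalityI subsetI)
    fix d assume d: "d \<in> edges H"
    then obtain i j where "d = {i, j}" "i \<in> f ` verts G" "j \<in> f ` verts G"
      using simple_graph.edgeE[OF assms(2)] bij_betw_imp_surj_on[OF f] by metis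
    then obtain x y where "d = f ` {x, y}" "x \<in> verts G" "y \<in> verts G"
      by auto
    moreover from this d adj have "{x, y} \<in> edges G"
      by simp
    ultimately show "d \<in> (\<lambda>e. f ` e) ` edges G"
      by blast
  next
    fix d assume "d \<in> (\<lambda>e. f ` e) ` edges G"
    then obtain e where e: "e \<in> edges G" "d = f ` e"
      by blast
    obtain x y where "e = {x, y}" "x \<in> verts G" "y \<in> verts G"
      using simple_graph.edgeE[OF assms(1) e(1)] .
    with e adj show "d \<in> edges H"
      by simp
  qed
qed

lemma (in simple_graph) ex_isomorphic_induced_subgraph_iff:
  assumes H: "simple_graph H"
  shows "(\<exists>S. S \<subseteq> verts G \<and> graph_isomorphic (induced_subgraph G S) H) \<longleftrightarrow>
    (\<exists>g. induced_embedding H G g)"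
proof
  assume "\<exists>S. S \<subseteq> verts G \<and> graph_isomorphic (induced_subgraph G S) H"
  then obtain S f where S: "S \<subseteq> verts G" and f: "bij_betw f S (verts H)"
    and image: "edges H = (\<lambda>e. f ` e) ` edges (induced_subgraph G S)"
    unfolding graph_isomorphic_def by auto
  have adj: "\<forall>x\<in>S. \<forall>y\<in>S. {x, y} \<in> edges G \<longleftrightarrow> {f x, f y} \<in> edges H"
    using edges_eq_image_iff[OF simple_graph_induced_subgraph H, of f S] f image by auto
  have g: "bij_betw (inv_into S f) (verts H) S"
    using f by (rule bij_betw_inv_into)
  then have "f (inv_into S f i) = i" "inv_into S f i \<in> S" if "i \<in> verts H" for i
    using that bij_betw_inv_into_right[OF f] bij_betwE by fast+
  then have "induced_embedding H G (inv_into S f)"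
    using g S adj unfolding induced_embedding_def bij_betw_def by auto
  then show "\<exists>g. induced_embedding H G g"
    by blast
next
  assume "\<exists>g. induced_embedding H G g"
  then obtain g where inj: "inj_on g (verts H)" and sub: "g ` verts H \<subseteq> verts G"
    and adj: "\<forall>i\<in>verts H. \<forall>j\<in>verts H. {g i, g j} \<in> edges G \<longleftrightarrow> {i, j} \<in> edges H"
    unfolding induced_embedding_def by blast
  define f where "f = inv_into (verts H) g"
  have f: "bij_betw f (g ` verts H) (verts H)"
    using inj unfolding f_def by (intro bij_betw_inv_into inj_on_imp_bij_betw)
  have "f (g i) = i" if "i \<in> verts H" for i
    using inj that by (simp add: f_def)
  then have "edges H = (\<lambda>e. f ` e) ` edges (induced_subgraph G (g ` verts H))"
    using f adj by (subst edges_eq_image_iff[OF simple_graph_induced_subgraph H]) auto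
  with f sub show "\<exists>S. S \<subseteq> verts G \<and> graph_isomorphic (induced_subgraph G S) H"
    unfolding graph_isomorphic_def by auto
qed

section \<open>Even triples\<close>

context simple_graph
begin

text \<open>Triples with repeated vertices satisfy the equivalence because there are no loops.\<close>

definition even_triples :: "'a set \<Rightarrow> bool" where
  "even_triples S \<longleftrightarrow> (\<forall>x\<in>S. \<forall>y\<in>S. \<forall>z\<in>S.
     {x, z} \<in> edges G \<longleftrightarrow> ({x, y} \<in> edges G) \<noteq> ({y, z} \<in> edges G))"

lemma even_triplesD:
  "even_triples S \<Longrightarrow> x \<in> S \<Longrightarrow> y \<in> S \<Longrightarrow> z \<in> S \<Longrightarrow>
    {x, z} \<in> edges G \<longleftrightarrow> ({x, y} \<in> edges G) \<noteq> ({y, z} \<in> edges G)"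
  unfolding even_triples_def by blast

lemma even_triples_subset: "even_triples S \<Longrightarrow> T \<subseteq> S \<Longrightarrow> even_triples T"
  unfolding even_triples_def by blast

lemma even_triples_Union:
  assumes "\<And>e f g. e \<in> C \<Longrightarrow> f \<in> C \<Longrightarrow> g \<in> C \<Longrightarrow> even_triples (e \<union> f \<union> g)"
  shows "even_triples (\<Union>C)"
  unfolding even_triples_def
proof (intro ballI)
  fix x y z assume "x \<in> \<Union>C" "y \<in> \<Union>C" "z \<in> \<Union>C"
  then obtain e f g where "e \<in> C" "f \<in> C" "g \<in> C" "x \<in> e" "y \<in> f" "z \<in> g"
    by blast
  then show "{x, z} \<in> edges G \<longleftrightarrow> ({x, y} \<in> edges G) \<noteq> ({y, z} \<in> edges G)"
    using even_triplesD[OF assms[of e f g], of x y z] by simp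
qed

lemma even_triples_edge:
  assumes "e \<in> edges G"
  shows "even_triples e"
proof -
  obtain x y where "e = {x, y}"
    using assms by (rule edgeE)
  with assms show ?thesis
    by (auto simp: even_triples_def insert_commute)
qed

lemma even_triples_Un_edges_iff:
  assumes "{x, x'} \<in> edges G" "{y, y'} \<in> edges G"
  shows "even_triples ({x, x'} \<union> {y, y'}) \<longleftrightarrow>
    ({x, y} \<in> edges G \<longleftrightarrow> {x, y'} \<notin> edges G) \<and>
    ({x', y'} \<in> edges G \<longleftrightarrow> {x, y} \<in> edges G) \<and>
    ({x', y} \<in> edges G \<longleftrightarrow> {x, y'} \<in> edges G)"
  using assms unfolding even_triples_def by (auto simp: insert_commute)

lemma even_triples_Un_three_edges_iff:
  assumes "{x, x'} \<in> edges G" "{y, y'} \<in> edges G" "{z, z'} \<in> edges G"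
    and "even_triples ({x, x'} \<union> {y, y'})" "even_triples ({y, y'} \<union> {z, z'})"
      "even_triples ({x, x'} \<union> {z, z'})"
  shows "even_triples ({x, x'} \<union> {y, y'} \<union> {z, z'}) \<longleftrightarrow>
    ({x, z} \<in> edges G \<longleftrightarrow> ({x, y} \<in> edges G) \<noteq> ({y, z} \<in> edges G))"
proof -
  note even_pairs = assms(4-6)[unfolded even_triples_Un_edges_iff[OF assms(1,2)]
      even_triples_Un_edges_iff[OF assms(2,3)] even_triples_Un_edges_iff[OF assms(1,3)]]
  show ?thesis
    using even_pairs assms(1-3) unfolding even_triples_def by (simp add: insert_commute) argo
qed

lemma complete_bipartite_imp_even_triples:
  assumes "complete_bipartite_graph (induced_subgraph G S)"
  shows "even_triples S"
proof -
  obtain X Y where sides: "X \<inter> Y = {}" "S = X \<union> Y"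
    and edges: "{e \<in> edges G. e \<subseteq> S} = {{x, y} | x y. x \<in> X \<and> y \<in> Y}"
    using assms unfolding complete_bipartite_graph_def by auto
  have "{x, y} \<in> edges G \<longleftrightarrow> (x \<in> X) \<noteq> (y \<in> X)" if "x \<in> S" "y \<in> S" for x y
  proof -
    have "{x, y} \<in> edges G \<longleftrightarrow> {x, y} \<in> {{x, y} | x y. x \<in> X \<and> y \<in> Y}"
      using that edges by blast
    also have "\<dots> \<longleftrightarrow> (x \<in> X) \<noteq> (y \<in> X)"
      using that sides by (auto simp: doubleton_eq_iff)
    finally show ?thesis .
  qed
  then show ?thesis
    unfolding even_triples_def by blast
qed

lemma even_triples_imp_complete_bipartite:
  assumes S: "even_triples S" and "e \<in> edges G" "e \<subseteq> S"
  shows "complete_bipartite_graph (induced_subgraph G S)"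
proof -
  obtain u v where uv: "{u, v} \<in> edges G" "u \<in> S" "v \<in> S"
    using assms(2,3) by (metis edgeE insert_subset)
  define X where "X = {x \<in> S. {x, v} \<in> edges G}"
  define Y where "Y = {y \<in> S. {v, y} \<notin> edges G}"
  have adj: "{x, y} \<in> edges G \<longleftrightarrow> x \<in> X \<and> y \<in> Y \<or> y \<in> X \<and> x \<in> Y" if "x \<in> S" "y \<in> S" for x y
    using even_triplesD[OF S that(1) uv(3) that(2)] that by (auto simp: X_def Y_def insert_commute)
  have "{e \<in> edges G. e \<subseteq> S} = {{x, y} | x y. x \<in> X \<and> y \<in> Y}"
  proof (intro equalityI subsetI)
    fix e assume e: "e \<in> {e \<in> edges G. e \<subseteq> S}"
    then obtain x y where "e = {x, y}"
      by (auto elim: edgeE)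
    moreover from this e have "x \<in> X \<and> y \<in> Y \<or> y \<in> X \<and> x \<in> Y"
      using adj by auto
    ultimately show "e \<in> {{x, y} | x y. x \<in> X \<and> y \<in> Y}"
      using insert_commute[of x y "{}"] by (elim disjE) blast+
  next
    fix e assume "e \<in> {{x, y} | x y. x \<in> X \<and> y \<in> Y}"
    then show "e \<in> {e \<in> edges G. e \<subseteq> S}"
      using adj by (auto simp: X_def Y_def)
  qed
  moreover have "u \<in> X" "v \<in> Y" "X \<inter> Y = {}" "S = X \<union> Y"
    using uv by (auto simp: X_def Y_def insert_commute)
  ultimately show ?thesis
    unfolding complete_bipartite_graph_def by auto
qed

section \<open>Sets of edges with even triples\<close>

definition jointly_even :: "'a set set set" where
  "jointly_even = {C. C \<noteq> {} \<and> C \<subseteq> edges G \<and> even_triples (\<Union>C)}"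

definition pairwise_even :: "'a set set set" where
  "pairwise_even = {C. C \<noteq> {} \<and> C \<subseteq> edges G \<and> (\<forall>e\<in>C. \<forall>f\<in>C. even_triples (e \<union> f))}"

lemma nonempty_subset_closed_jointly_even: "nonempty_subset_closed jointly_even"
  unfolding nonempty_subset_closed_def jointly_even_def
  using even_triples_subset by (auto dest: Union_mono)

lemma nonempty_subset_closed_pairwise_even: "nonempty_subset_closed pairwise_even"
  unfolding nonempty_subset_closed_def pairwise_even_def by blast

lemma finite_jointly_even: "finite (verts G) \<Longrightarrow> finite jointly_even"
  by (rule finite_subset[of _ "Pow (edges G)"]) (auto simp: jointly_even_def finite_edges)

lemma finite_pairwise_even: "finite (verts G) \<Longrightarrow> finite pairwise_even"
  by (rule finite_subset[of _ "Pow (edges G)"]) (auto simp: pairwise_even_def finite_edges)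

lemma jointly_even_imp_complete_bipartite:
  assumes "C \<in> jointly_even"
  shows "complete_bipartite_graph (induced_subgraph G (\<Union>C))"
proof -
  obtain e where "e \<in> C"
    using assms unfolding jointly_even_def by blast
  then show ?thesis
    using assms unfolding jointly_even_def
    by (intro even_triples_imp_complete_bipartite[of _ e]) auto
qed

lemma Union_edges_complete_bipartite:
  assumes "complete_bipartite_graph (induced_subgraph G B)"
  shows "\<Union>(edges (induced_subgraph G B)) = B"
proof -
  obtain X Y where sides: "X \<noteq> {}" "Y \<noteq> {}" "B = X \<union> Y"
    and edges: "edges (induced_subgraph G B) = {{x, y} | x y. x \<in> X \<and> y \<in> Y}"
    using assms unfolding complete_bipartite_graph_def by auto
  have "\<Union>{{x, y} | x y. x \<in> X \<and> y \<in> Y} = X \<union> Y"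
    using sides(1,2) by blast
  then show ?thesis
    unfolding edges by (simp only: sides(3))
qed

lemma edges_complete_bipartite_in_jointly_even:
  assumes "complete_bipartite_graph (induced_subgraph G B)"
  shows "edges (induced_subgraph G B) \<in> jointly_even"
  unfolding jointly_even_def
proof (intro CollectI conjI)
  have "B \<noteq> {}"
    using assms unfolding complete_bipartite_graph_def by auto
  then show "edges (induced_subgraph G B) \<noteq> {}"
    using Union_edges_complete_bipartite[OF assms] by (metis Union_empty)
  show "edges (induced_subgraph G B) \<subseteq> edges G"
    by simp
  show "even_triples (\<Union>(edges (induced_subgraph G B)))"
    unfolding Union_edges_complete_bipartite[OF assms]
    using assms by (rule complete_bipartite_imp_even_triples)
qed

lemma edges_biclique_in_maximal_sets:
  assumes B: "is_biclique G B"
  shows "edges (induced_subgraph G B) \<in> maximal_sets jointly_even"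
  unfolding maximal_sets_def
proof (intro CollectI conjI ballI impI)
  have bipartite: "complete_bipartite_graph (induced_subgraph G B)"
    using B by (simp add: is_biclique_def)
  then show "edges (induced_subgraph G B) \<in> jointly_even"
    by (rule edges_complete_bipartite_in_jointly_even)
  fix C assume C: "C \<in> jointly_even" "edges (induced_subgraph G B) \<subseteq> C"
  then have "C \<subseteq> edges G"
    by (simp add: jointly_even_def)
  then have "\<Union>C \<subseteq> verts G"
    using edge_subset_verts by blast
  moreover have "B \<subseteq> \<Union>C"
    using C(2) Union_edges_complete_bipartite[OF bipartite] by blast
  ultimately have "\<Union>C = B"
    using B jointly_even_imp_complete_bipartite[OF C(1)] by (simp add: is_biclique_def)
  with C \<open>C \<subseteq> edges G\<close> show "edges (induced_subgraph G B) = C"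
    by auto
qed

lemma maximal_jointly_even_imp_biclique:
  assumes "C \<in> maximal_sets jointly_even"
  shows "is_biclique G (\<Union>C)" "C = edges (induced_subgraph G (\<Union>C))"
proof -
  have C: "C \<in> jointly_even" and max: "\<And>D. D \<in> jointly_even \<Longrightarrow> C \<subseteq> D \<Longrightarrow> C = D"
    using assms by (simp_all add: maximal_sets_def)
  have bipartite: "complete_bipartite_graph (induced_subgraph G (\<Union>C))"
    using C by (rule jointly_even_imp_complete_bipartite)
  have edges_eq: "C = edges (induced_subgraph G B)"
    if "\<Union>C \<subseteq> B" "complete_bipartite_graph (induced_subgraph G B)" for B
  proof (rule max)
    show "edges (induced_subgraph G B) \<in> jointly_even"
      using that(2) by (rule edges_complete_bipartite_in_jointly_even)
    show "C \<subseteq> edges (induced_subgraph G B)"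
      using C that(1) by (auto simp: jointly_even_def)
  qed
  show "C = edges (induced_subgraph G (\<Union>C))"
    using edges_eq[OF subset_refl bipartite] .
  have "B = \<Union>C" if "\<Union>C \<subseteq> B" "complete_bipartite_graph (induced_subgraph G B)" for B
    using edges_eq[OF that] Union_edges_complete_bipartite[OF that(2)] by simp
  moreover have "\<Union>C \<subseteq> verts G"
    using C edge_subset_verts by (auto simp: jointly_even_def)
  ultimately show "is_biclique G (\<Union>C)"
    using bipartite by (simp add: is_biclique_def)
qed

lemma edge_biclique_hypergraph_eq:
  "edge_biclique_hypergraph G = (edges G, maximal_sets jointly_even)"
  unfolding edge_biclique_hypergraph_def
  using edges_biclique_in_maximal_sets maximal_jointly_even_imp_biclique by blast

section \<open>The biclique line graph\<close>

lemma simple_graph_biclique_line_graph: "simple_graph (biclique_line_graph G)"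
  by unfold_locales (fastforce simp: biclique_line_graph_def card_2_iff)+

lemma verts_biclique_line_graph: "verts (biclique_line_graph G) = edges G"
  by (simp add: biclique_line_graph_def)

lemma biclique_line_graph_edge_iff:
  assumes fin: "finite (verts G)" and edges: "e \<in> edges G" "f \<in> edges G" "e \<noteq> f"
  shows "{e, f} \<in> edges (biclique_line_graph G) \<longleftrightarrow> even_triples (e \<union> f)"
proof -
  have "{e, f} \<in> edges (biclique_line_graph G) \<longleftrightarrow>
      (\<exists>B. is_biclique G B \<and> {e, f} \<subseteq> edges (induced_subgraph G B))"
    using edges by (auto simp: biclique_line_graph_def doubleton_eq_iff)
  also have "\<dots> \<longleftrightarrow> (\<exists>M\<in>edges (edge_biclique_hypergraph G). {e, f} \<subseteq> M)"
    unfolding edge_biclique_hypergraph_def by auto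
  also have "\<dots> \<longleftrightarrow> {e, f} \<in> jointly_even"
    using mem_iff_subset_maximal_set[OF finite_jointly_even[OF fin]
        nonempty_subset_closed_jointly_even]
    by (simp add: edge_biclique_hypergraph_eq)
  also have "\<dots> \<longleftrightarrow> even_triples (e \<union> f)"
    using edges by (simp add: jointly_even_def)
  finally show ?thesis .
qed

lemma complete_induced_biclique_line_graph_iff:
  assumes "finite (verts G)"
  shows "C \<subseteq> edges G \<and> complete_graph (induced_subgraph (biclique_line_graph G) C) \<longleftrightarrow>
    C \<in> pairwise_even"
  using even_triples_edge biclique_line_graph_edge_iff[OF assms]
  unfolding simple_graph.complete_induced_subgraph_iff[OF simple_graph_biclique_line_graph]
    pairwise_even_def subset_iff mem_Collect_eq by (metis Un_absorb)

lemma clique_hypergraph_biclique_line_graph_eq: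
  assumes "finite (verts G)"
  shows "clique_hypergraph (biclique_line_graph G) = (edges G, maximal_sets pairwise_even)"
  unfolding clique_hypergraph_eq verts_biclique_line_graph
    complete_induced_biclique_line_graph_iff[OF assms] by simp

section \<open>Induced prisms\<close>

text \<open>The triangles of the prism need not be mentioned: the odd triple forces them.\<close>

definition prism_rungs :: "'a set \<Rightarrow> 'a set \<Rightarrow> 'a set \<Rightarrow> bool" where
  "prism_rungs d e f \<longleftrightarrow> d \<in> edges G \<and> e \<in> edges G \<and> f \<in> edges G \<and>
     even_triples (d \<union> e) \<and> even_triples (e \<union> f) \<and> even_triples (d \<union> f) \<and>
     \<not> even_triples (d \<union> e \<union> f)"

lemma jointly_even_eq_pairwise_even_iff:
  "jointly_even = pairwise_even \<longleftrightarrow> (\<nexists>d e f. prism_rungs d e f)"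
proof
  assume eq: "jointly_even = pairwise_even"
  show "\<nexists>d e f. prism_rungs d e f"
  proof
    assume "\<exists>d e f. prism_rungs d e f"
    then obtain d e f where rungs: "prism_rungs d e f"
      by blast
    then have "{d, e, f} \<in> pairwise_even"
      by (auto simp: prism_rungs_def pairwise_even_def even_triples_edge Un_commute)
    with rungs show False
      unfolding eq[symmetric] by (simp add: jointly_even_def prism_rungs_def Un_assoc)
  qed
next
  assume no_rungs: "\<nexists>d e f. prism_rungs d e f"
  show "jointly_even = pairwise_even"
  proof (intro equalityI subsetI)
    fix C assume "C \<in> jointly_even"
    then show "C \<in> pairwise_even"
      unfolding jointly_even_def pairwise_even_def
      by (auto intro: even_triples_subset)
  next
    fix C assume C: "C \<in> pairwise_even"
    then have "even_triples (\<Union>C)"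
      using no_rungs
      by (intro even_triples_Union) (simp add: pairwise_even_def prism_rungs_def subset_iff)
    with C show "C \<in> jointly_even"
      by (simp add: jointly_even_def pairwise_even_def)
  qed
qed

lemma prism_rungs_triangleE:
  assumes rungs: "prism_rungs d e f"
  obtains x x' y y' z z' where "d = {x, x'}" "e = {y, y'}" "f = {z, z'}"
    "{x, y} \<in> edges G" "{y, z} \<in> edges G" "{x, z} \<in> edges G"
proof -
  have edges: "d \<in> edges G" "e \<in> edges G" "f \<in> edges G"
    and even: "even_triples (d \<union> e)" "even_triples (e \<union> f)" "even_triples (d \<union> f)"
    and odd: "\<not> even_triples (d \<union> e \<union> f)"
    using rungs by (simp_all add: prism_rungs_def)
  obtain x x' where d: "d = {x, x'}"
    using edges(1) by (rule edgeE)
  have neighbour: "\<exists>w w'. h = {w, w'} \<and> {x, w} \<in> edges G"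
    if edge: "h \<in> edges G" "even_triples (d \<union> h)" for h
  proof -
    obtain w w' where ends: "h = {w, w'}"
      using edge(1) by (rule edgeE)
    then have "{x, w} \<in> edges G \<or> {x, w'} \<in> edges G"
      using even_triples_Un_edges_iff[of x x' w w'] edges(1) edge unfolding d by blast
    with ends show ?thesis
      by (metis insert_commute)
  qed
  obtain y y' where e: "e = {y, y'}" and xy: "{x, y} \<in> edges G"
    using neighbour edges(2) even(1) by blast
  obtain z z' where f: "f = {z, z'}" and xz: "{x, z} \<in> edges G"
    using neighbour edges(3) even(3) by blast
  have "{y, z} \<in> edges G"
    using even_triples_Un_three_edges_iff[of x x' y y' z z'] edges even odd xy xz
    unfolding d e f by simp
  with d e f xy xz show thesis
    by (intro that)
qed

lemma prism_rungs_imp_induced_embedding: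
  assumes rungs: "prism_rungs {x, x'} {y, y'} {z, z'}"
    and triangle: "{x, y} \<in> edges G" "{y, z} \<in> edges G" "{x, z} \<in> edges G"
  shows "induced_embedding triangular_prism G (nth [x, y, z, x', y', z'])"
proof -
  have edges: "{x, x'} \<in> edges G" "{y, y'} \<in> edges G" "{z, z'} \<in> edges G"
    and even: "even_triples ({x, x'} \<union> {y, y'})" "even_triples ({y, y'} \<union> {z, z'})"
      "even_triples ({x, x'} \<union> {z, z'})"
    using rungs by (simp_all add: prism_rungs_def)
  have adj: "{x', y'} \<in> edges G" "{y', z'} \<in> edges G" "{x', z'} \<in> edges G"
    "{x, y'} \<notin> edges G" "{x', y} \<notin> edges G" "{y, z'} \<notin> edges G" "{y', z} \<notin> edges G"
    "{x, z'} \<notin> edges G" "{x', z} \<notin> edges G"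
    using even triangle unfolding even_triples_Un_edges_iff[OF edges(1,2)]
      even_triples_Un_edges_iff[OF edges(2,3)] even_triples_Un_edges_iff[OF edges(1,3)] by auto
  have "distinct [x, y, z, x', y', z']"
    using edges triangle adj by (auto simp: insert_commute)
  then have "inj_on (nth [x, y, z, x', y', z']) (verts triangular_prism)"
    by (rule inj_on_nth) (auto simp: triangular_prism_def)
  moreover have "nth [x, y, z, x', y', z'] ` verts triangular_prism \<subseteq> verts G"
    using edges[THEN edge_subset_verts] by (simp add: triangular_prism_def)
  ultimately show ?thesis
    using edges triangle adj unfolding induced_embedding_def
    by (simp add: triangular_prism_def doubleton_eq_iff insert_commute)
qed

lemma induced_embedding_imp_prism_rungs:
  assumes "induced_embedding triangular_prism G g"
  shows "prism_rungs {g 0, g 3} {g 1, g 4} {g 2, g 5}"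
proof -
  have adj: "{g i, g j} \<in> edges G \<longleftrightarrow> {i, j} \<in> edges triangular_prism"
    if "i \<in> verts triangular_prism" "j \<in> verts triangular_prism" for i j
    using assms that by (simp add: induced_embedding_def)
  have edges: "{g 0, g 3} \<in> edges G" "{g 1, g 4} \<in> edges G" "{g 2, g 5} \<in> edges G"
    and triangle: "{g 0, g 1} \<in> edges G" "{g 1, g 2} \<in> edges G" "{g 0, g 2} \<in> edges G"
    and opposite: "{g 3, g 4} \<in> edges G" "{g 4, g 5} \<in> edges G" "{g 3, g 5} \<in> edges G"
    and cross: "{g 0, g 4} \<notin> edges G" "{g 3, g 1} \<notin> edges G" "{g 1, g 5} \<notin> edges G"
      "{g 4, g 2} \<notin> edges G" "{g 0, g 5} \<notin> edges G" "{g 3, g 2} \<notin> edges G"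
    by (subst adj; simp add: triangular_prism_def doubleton_eq_iff)+
  have "even_triples ({g 0, g 3} \<union> {g 1, g 4})" "even_triples ({g 1, g 4} \<union> {g 2, g 5})"
    "even_triples ({g 0, g 3} \<union> {g 2, g 5})"
    using triangle opposite cross unfolding even_triples_Un_edges_iff[OF edges(1,2)]
      even_triples_Un_edges_iff[OF edges(2,3)] even_triples_Un_edges_iff[OF edges(1,3)] by auto
  moreover have "\<not> even_triples ({g 0, g 3} \<union> {g 1, g 4} \<union> {g 2, g 5})"
    using even_triplesD[of "{g 0, g 3} \<union> {g 1, g 4} \<union> {g 2, g 5}" "g 0" "g 1" "g 2"] triangle
    by auto
  ultimately show ?thesis
    using edges unfolding prism_rungs_def by blast
qed

lemma ex_induced_embedding_prism_iff:
  "(\<exists>g. induced_embedding triangular_prism G g) \<longleftrightarrow> (\<exists>d e f. prism_rungs d e f)"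
proof
  assume "\<exists>g. induced_embedding triangular_prism G g"
  then show "\<exists>d e f. prism_rungs d e f"
    using induced_embedding_imp_prism_rungs by blast
next
  assume "\<exists>d e f. prism_rungs d e f"
  then obtain d e f where rungs: "prism_rungs d e f"
    by blast
  then obtain x x' y y' z z' where "d = {x, x'}" "e = {y, y'}" "f = {z, z'}"
    and triangle: "{x, y} \<in> edges G" "{y, z} \<in> edges G" "{x, z} \<in> edges G"
    by (rule prism_rungs_triangleE)
  with rungs have "prism_rungs {x, x'} {y, y'} {z, z'}"
    by simp
  from prism_rungs_imp_induced_embedding[OF this triangle]
  show "\<exists>g. induced_embedding triangular_prism G g"
    by blast
qed

end

lemma simple_graph_triangular_prism: "simple_graph triangular_prism"
  by unfold_locales (auto simp: triangular_prism_def)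

theorem theorem5:
  fixes G :: "'a hypergraph"
  assumes "finite_simple_graph G"
  shows "edge_biclique_hypergraph G = clique_hypergraph (biclique_line_graph G) \<longleftrightarrow>
    \<not> (\<exists>S. S \<subseteq> verts G \<and> graph_isomorphic (induced_subgraph G S) triangular_prism)"
proof -
  interpret simple_graph G
    using assms by unfold_locales (auto simp: finite_simple_graph_def)
  have fin: "finite (verts G)"
    using assms by (simp add: finite_simple_graph_def)
  have "edge_biclique_hypergraph G = clique_hypergraph (biclique_line_graph G) \<longleftrightarrow>
      maximal_sets jointly_even = maximal_sets pairwise_even"
    by (simp add: edge_biclique_hypergraph_eq clique_hypergraph_biclique_line_graph_eq[OF fin])
  also have "\<dots> \<longleftrightarrow> jointly_even = pairwise_even"
    by (intro maximal_sets_eq_iff finite_jointly_even finite_pairwise_even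
        nonempty_subset_closed_jointly_even nonempty_subset_closed_pairwise_even fin)
  also have "\<dots> \<longleftrightarrow> \<not> (\<exists>g. induced_embedding triangular_prism G g)"
    unfolding jointly_even_eq_pairwise_even_iff ex_induced_embedding_prism_iff ..
  also have "\<dots> \<longleftrightarrow>
      \<not> (\<exists>S. S \<subseteq> verts G \<and> graph_isomorphic (induced_subgraph G S) triangular_prism)"
    by (simp only: ex_isomorphic_induced_subgraph_iff[OF simple_graph_triangular_prism])
  finally show ?thesis .
qed

end
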